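(* Let $F(w)=\mathbb{E}[f(w;\xi)]$, $w\in\mathbb{R}^d$. Assume: (1) $F$ is $\mu$-strongly convex for some $\mu>0$; (2) for every realization of $\xi$, $f(\cdot;\xi)$ is $L$-smooth, with a common constant $L>0$; (3) for every realization of $\xi$, $f(\cdot;\xi)$ is convex. Let $w_*$ be the unique minimizer of $F$ and assume $\mathbb{E}[\|\nabla f(w_*;\xi)\|^2]<\infty$. Consider the SGD iteration $w_{t+1}=w_t-\eta_t\nabla f(w_t;\xi_t)$, $t\ge 0$, started from a given $w_0\in\mathbb{R}^d$, with a step size sequence satisfying $$0<\eta_t\le \frac{1}{2L}\ \ (t\ge 0),\qquad \sum_{t=0}^\infty \eta_t=\infty,\qquad \sum_{t=0}^\infty \eta_t^2<\infty .$$ Then, with probability one, $\|w_t-w_*\|^2\to 0$ as $t\to\infty$.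
   Context: $\xi$ is a random variable with some distribution, and $f(\cdot;\xi):\mathbb{R}^d\to\mathbb{R}$ is differentiable for each realization of $\xi$. The stochastic gradient is unbiased: $\mathbb{E}[\nabla f(w;\xi)]=\nabla F(w)$ for every fixed $w$. The variables $\xi_0,\xi_1,\dots$ are i.i.d. copies of $\xi$. The step sizes $\eta_t$ are deterministic. $\|\cdot\|$ is the Euclidean norm. $\mu$-strongly convex: $F(w)-F(w')\ge\langle\nabla F(w'),w-w'\rangle+\frac{\mu}{2}\|w-w'\|^2$ for all $w,w'\in\mathbb{R}^d$. $L$-smooth: $\|\nabla f(w;\xi)-\nabla f(w';\xi)\|\le L\|w-w'\|$ for all $w,w'\in\mathbb{R}^d$. Convex: $f(w;\xi)-f(w';\xi)\ge\langle\nabla f(w';\xi),w-w'\rangle$ for all $w,w'\in\mathbb{R}^d$. *)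

theory Defs
  imports "HOL-Probability.Probability"
begin

text \<open>
  The gradient as a total function; it is the genuine gradient wherever the function is
  differentiable and unspecified elsewhere, so differentiability has to be required separately.
\<close>

definition gradient :: "('a::euclidean_space \<Rightarrow> real) \<Rightarrow> 'a \<Rightarrow> 'a" where
  "gradient h w = (THE D. GDERIV h w :> D)"

text \<open>
  The next three notions are the first-order ones for functions already known to be
  differentiable; none of them contains differentiability itself.
\<close>

definition strongly_convex_fun :: "real \<Rightarrow> ('a::euclidean_space \<Rightarrow> real) \<Rightarrow> bool" where
  "strongly_convex_fun \<mu> h \<longleftrightarrow>
     (\<forall>w w'. h w - h w' \<ge> gradient h w' \<bullet> (w - w') + \<mu> / 2 * (norm (w - w'))\<^sup>2)"

definition smooth_fun :: "real \<Rightarrow> ('a::euclidean_space \<Rightarrow> real) \<Rightarrow> bool" where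
  "smooth_fun L h \<longleftrightarrow> (\<forall>w w'. norm (gradient h w - gradient h w') \<le> L * norm (w - w'))"

definition convex_fun :: "('a::euclidean_space \<Rightarrow> real) \<Rightarrow> bool" where
  "convex_fun h \<longleftrightarrow> (\<forall>w w'. h w - h w' \<ge> gradient h w' \<bullet> (w - w'))"

primrec sgd ::
  "('a::euclidean_space \<Rightarrow> 's \<Rightarrow> real) \<Rightarrow> (nat \<Rightarrow> real) \<Rightarrow> (nat \<Rightarrow> '\<omega> \<Rightarrow> 's) \<Rightarrow> 'a \<Rightarrow> nat \<Rightarrow> '\<omega> \<Rightarrow> 'a"
where
  "sgd f \<eta> X w0 0 \<omega> = w0"
| "sgd f \<eta> X w0 (Suc t) \<omega> =
     sgd f \<eta> X w0 t \<omega> - \<eta> t *\<^sub>R gradient (\<lambda>v. f v (X t \<omega>)) (sgd f \<eta> X w0 t \<omega>)"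

end

theory Submission imports Defs begin

text \<open>
  Put $D_t = \|w_t - w_*\|^2$. The $L$-smoothness gives
  $\|\nabla f(w;\xi)\|^2 \le 2L^2\|w-w_*\|^2 + 2\|\nabla f(w_*;\xi)\|^2$, and strong convexity
  together with $F(w_*) \le F(w)$ gives $\langle\nabla F(w), w-w_*\rangle \ge \frac{\mu}{2}\|w-w_*\|^2$.
  As $\xi_t$ is independent of $w_t$, conditionally on the past $D_{t+1}$ has mean at most
  $(1 - \mu\eta_t + 2L^2\eta_t^2) D_t + \eta_t^2 N$ with $N = 2\,E\|\nabla f(w_*;\xi)\|^2$, and the factor is at most
  $1 - \frac{\mu}{2}\eta_t$ once $\eta_t$ is small. Hence the mean of $D_t$ tends to $0$, and
  $D_t + N\sum_{k\ge t}\eta_k^2$ is eventually a nonnegative supermartingale. The maximal inequality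
  started at time $m$ bounds the probability that it ever reaches $\varepsilon$ after $m$ by its mean at
  time $m$ over $\varepsilon$, which vanishes as $m \to \infty$.
\<close>

section \<open>Gradients: existence and measurability\<close>

text \<open>The definite description denotes something only once a representing vector exists and is
  unique. Existence is Riesz representation, with representer \<open>adjoint D 1\<close>; uniqueness
  follows from uniqueness of derivatives, since the inner product separates vectors.\<close>

lemma gradient_gderiv:
  fixes h :: "'a::euclidean_space \<Rightarrow> real"
  assumes "h differentiable (at w)"
  shows "GDERIV h w :> gradient h w"
proof -
  obtain D where D: "(h has_derivative D) (at w)"
    using assms unfolding differentiable_def by blast
  interpret D: bounded_linear D using D by (rule has_derivative_bounded_linear)
  have "D v = v \<bullet> adjoint D 1" for v
    using adjoint_works[OF D.linear, of v 1] by simp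
  then have "D = (\<lambda>v. v \<bullet> adjoint D 1)" by auto
  with D have *: "GDERIV h w :> adjoint D 1" by (simp add: gderiv_def)
  moreover have "D' = adjoint D 1" if "GDERIV h w :> D'" for D'
  proof -
    have "(\<lambda>v. v \<bullet> D') = (\<lambda>v. v \<bullet> adjoint D 1)"
      using that * unfolding gderiv_def by (rule has_derivative_unique)
    then show ?thesis by (subst vector_eq_ldot[symmetric]) (simp add: fun_eq_iff)
  qed
  ultimately show ?thesis unfolding gradient_def by (rule theI)
qed

text \<open>Each coordinate of the gradient is a pointwise limit of difference quotients along the
  steps 1/(n+1), and for fixed \<open>w\<close> these are measurable in the sample.\<close>

lemma measurable_gradient:
  fixes f :: "'a::euclidean_space \<Rightarrow> 's \<Rightarrow> real"
  assumes meas: "\<And>w. f w \<in> borel_measurable S"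
    and diff: "\<And>s. s \<in> space S \<Longrightarrow> (\<lambda>v. f v s) differentiable (at w)"
  shows "(\<lambda>s. gradient (\<lambda>v. f v s) w) \<in> borel_measurable S"
proof (subst borel_measurable_euclidean_space, intro ballI)
  fix b :: 'a
  assume "b \<in> Basis"
  note [measurable] = meas
  show "(\<lambda>s. gradient (\<lambda>v. f v s) w \<bullet> b) \<in> borel_measurable S"
  proof (rule borel_measurable_LIMSEQ_real)
    fix s assume "s \<in> space S"
    then have "((\<lambda>v. f v s) has_derivative (\<lambda>h. h \<bullet> gradient (\<lambda>v. f v s) w)) (at w)"
      using gradient_gderiv[OF diff] by (simp add: gderiv_def)
    \<comment> \<open>The base point is written as the value at t = 0 of the line
      \<open>w + t *\<^sub>R b\<close>, the shape the chain rule needs.\<close>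
    then have "((\<lambda>v. f v s) has_derivative (\<lambda>h. h \<bullet> gradient (\<lambda>v. f v s) w)) (at (w + 0 *\<^sub>R b))"
      by simp
    then have "((\<lambda>t. f (w + t *\<^sub>R b) s) has_derivative (\<lambda>t. (t *\<^sub>R b) \<bullet> gradient (\<lambda>v. f v s) w)) (at 0)"
      by (rule has_derivative_compose[rotated]) (auto intro!: derivative_eq_intros)
    then have "((\<lambda>t. f (w + t *\<^sub>R b) s) has_real_derivative (gradient (\<lambda>v. f v s) w \<bullet> b)) (at 0)"
      by (rule has_derivative_imp_has_field_derivative) (simp add: inner_commute)
    then have "((\<lambda>t. (f (w + t *\<^sub>R b) s - f w s) / t) \<longlongrightarrow> gradient (\<lambda>v. f v s) w \<bullet> b) (at 0)"
      by (simp add: DERIV_def)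
    then show "(\<lambda>n. (f (w + inverse (real (Suc n)) *\<^sub>R b) s - f w s) / inverse (real (Suc n)))
        \<longlonglongrightarrow> gradient (\<lambda>v. f v s) w \<bullet> b"
      by (rule filterlim_compose)
         (auto simp: filterlim_at simp del: of_nat_Suc intro: LIMSEQ_inverse_real_of_nat)
  qed measurable
qed

text \<open>Joint measurability of Caratheodory functions. Replacing \<open>w\<close> by a simple
  function \<open>q i\<close> of \<open>w\<close> leaves finitely many sections, each measurable in
  \<open>s\<close>; continuity in \<open>w\<close> carries measurability to the limit.\<close>

lemma measurable_pair_continuous_left:
  fixes g :: "'a::{second_countable_topology, metric_space} \<Rightarrow> 's \<Rightarrow> 'b::{metric_space}"
  assumes meas: "\<And>w. g w \<in> borel_measurable S"
    and cont: "\<And>s. s \<in> space S \<Longrightarrow> continuous_on UNIV (\<lambda>w. g w s)"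
  shows "(\<lambda>(w, s). g w s) \<in> borel_measurable (borel \<Otimes>\<^sub>M S)"
proof -
  obtain q :: "nat \<Rightarrow> 'a \<Rightarrow> 'a" where q: "\<And>i. simple_function borel (q i)"
    and lim: "\<And>x. (\<lambda>i. q i x) \<longlonglongrightarrow> x"
    using borel_measurable_implies_sequence_metric[of "\<lambda>x::'a. x" borel undefined] by auto
  have "(\<lambda>p. g (q i (fst p)) (snd p)) \<in> borel_measurable (borel \<Otimes>\<^sub>M S)" for i
  proof (rule measurable_compose_countable'[where I = "range (q i)" and f = "\<lambda>c p. g c (snd p)"])
    show "(\<lambda>p. q i (fst p)) \<in> borel \<Otimes>\<^sub>M S \<rightarrow>\<^sub>M count_space (range (q i))"
    proof (rule measurable_compose[OF measurable_fst])
      show "q i \<in> borel \<rightarrow>\<^sub>M count_space (range (q i))"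
        using q[of i] by (auto simp: simple_function_def measurable_count_space_eq2)
    qed
    show "countable (range (q i))"
      using q[of i] by (simp add: simple_function_def countable_finite)
  qed (use meas in measurable)
  moreover have "(\<lambda>i. g (q i (fst p)) (snd p)) \<longlonglongrightarrow> g (fst p) (snd p)"
    if "p \<in> space (borel \<Otimes>\<^sub>M S)" for p
    using that by (intro continuous_on_tendsto_compose[OF cont lim]) (auto simp: space_pair_measure)
  ultimately show ?thesis
    unfolding case_prod_beta by (rule borel_measurable_LIMSEQ_metric)
qed

section \<open>Convergence of perturbed contractions and of almost supermartingales\<close>

text \<open>Adding the tails of \<open>b\<close> makes \<open>e\<close> decreasing, so
  \<open>e\<close> has a limit. Telescoping bounds the sums of \<open>a k * e k\<close>, which is
  incompatible with a positive limit when the sums of \<open>a\<close> diverge.\<close>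

lemma perturbed_contraction_tendsto_0:
  fixes e a b :: "nat \<Rightarrow> real"
  assumes e: "\<And>n. 0 \<le> e n" and a: "\<And>n. 0 \<le> a n" and b: "\<And>n. 0 \<le> b n" "summable b"
    and step: "\<And>n. e (Suc n) \<le> (1 - a n) * e n + b n"
    and div: "filterlim (\<lambda>n. \<Sum>k<n. a k) at_top sequentially"
  shows "e \<longlonglongrightarrow> 0"
proof -
  define B where "B n = (\<Sum>k. b (k + n))" for n
  define u where "u n = e n + B n" for n
  have B: "B n = b n + B (Suc n)" for n
    using suminf_split_head[of "\<lambda>k. b (k + n)"] b(2)
    by (simp add: B_def summable_iff_shift)
  have B0: "B \<longlonglongrightarrow> 0"
    unfolding B_def using suminf_exist_split2[OF b(2)] .
  have Bnn: "0 \<le> B n" for n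
    unfolding B_def by (intro suminf_nonneg) (auto simp: b summable_iff_shift)
  \<comment> \<open>The decrement \<open>a n * e n\<close> is kept: its sign gives monotonicity of
    \<open>u\<close>, and its sum gives \<open>sum_le\<close>.\<close>
  have u_step: "u (Suc n) + a n * e n \<le> u n" for n
    using step[of n] B[of n] by (simp add: u_def algebra_simps)
  have "decseq u"
    using u_step a e by (intro decseq_SucI) (smt (verit) mult_nonneg_nonneg)
  moreover have u_nn: "0 \<le> u n" for n using e[of n] Bnn[of n] by (simp add: u_def)
  ultimately obtain l where l: "u \<longlonglongrightarrow> l" "\<And>n. l \<le> u n"
    using decseq_convergent[of u 0] by metis
  have "e \<longlonglongrightarrow> l"
    using tendsto_diff[OF l(1) B0] by (simp add: u_def)
  have sum_le: "(\<Sum>k<n. a (k + m) * e (k + m)) \<le> u m" for n m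
  proof -
    have "(\<Sum>k<n. a (k + m) * e (k + m)) + u (n + m) \<le> u m"
    proof (induction n)
      case (Suc n)
      then show ?case using u_step[of "n + m"] by simp
    qed simp
    then show ?thesis using u_nn[of "n + m"] by linarith
  qed
  have "l = 0"
  proof (rule ccontr)
    assume "l \<noteq> 0"
    moreover have "0 \<le> l" using l(1) u_nn by (intro LIMSEQ_le_const) auto
    ultimately have "l > 0" by simp
    then have "eventually (\<lambda>n. e n > l / 2) sequentially"
      using \<open>e \<longlonglongrightarrow> l\<close> by (intro order_tendstoD(1)) auto
    then obtain m where m: "\<And>n. n \<ge> m \<Longrightarrow> e n > l / 2"
      by (auto simp: eventually_sequentially)
    have bound: "(\<Sum>k<n. a (k + m)) \<le> u m / (l / 2)" for n
    proof -
      have "(\<Sum>k<n. a (k + m)) * (l / 2) \<le> (\<Sum>k<n. a (k + m) * e (k + m))"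
        unfolding sum_distrib_right
        by (intro sum_mono mult_left_mono a less_imp_le[OF m]) auto
      also note sum_le
      finally show ?thesis using \<open>l > 0\<close> by (simp add: field_simps)
    qed
    \<comment> \<open>The shifted sums miss only the fixed first \<open>m\<close> terms, so the full
      sums are bounded too, contrary to \<open>div\<close>.\<close>
    have "(\<Sum>k<n. a k) \<le> (\<Sum>k<m. a k) + u m / (l / 2)" for n
    proof -
      have "(\<Sum>k<n. a k) \<le> (\<Sum>k<n + m. a k)"
        by (intro sum_mono2) (auto simp: a)
      also have "\<dots> = (\<Sum>k<m. a k) + (\<Sum>k<n. a (k + m))"
        by (induction n) (auto simp: add_ac)
      finally show ?thesis using bound[of n] by linarith
    qed
    moreover obtain n where "(\<Sum>k<n. a k) > (\<Sum>k<m. a k) + u m / (l / 2)"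
      using div by (metis (no_types, lifting) eventually_sequentially filterlim_at_top_dense order_refl)
    ultimately show False by (meson not_le)
  qed
  with \<open>e \<longlonglongrightarrow> l\<close> show ?thesis by simp
qed


text \<open>Ville's inequality for nonnegative supermartingales. Integrals over events of
  \<open>F n\<close> stand in for conditional expectations, and measurability of \<open>V k\<close>
  in every later \<open>F n\<close> carries the monotonicity of the filtration.\<close>

lemma maximal_inequality:
  fixes V :: "nat \<Rightarrow> 'a \<Rightarrow> ennreal"
  assumes sub: "\<And>n. subalgebra M (F n)"
    and adapted: "\<And>k n. k \<le> n \<Longrightarrow> V k \<in> borel_measurable (F n)"
    and step: "\<And>n B. B \<in> sets (F n) \<Longrightarrow>
      (\<integral>\<^sup>+x. V (Suc n) x * indicator B x \<partial>M) \<le> (\<integral>\<^sup>+x. V n x * indicator B x \<partial>M)"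
  shows "c * emeasure M {x \<in> space M. \<exists>n. c \<le> V n x} \<le> (\<integral>\<^sup>+x. V 0 x \<partial>M)"
proof -
  \<comment> \<open>Induction on the horizon: the mass already absorbed in \<open>A n\<close> plus what survives
    on \<open>B n\<close> never exceeds the initial mean.\<close>
  define A where "A n = {x \<in> space M. \<exists>k\<le>n. c \<le> V k x}" for n
  define B where "B n = {x \<in> space M. \<forall>k\<le>n. V k x < c}" for n
  have B_A: "B n = space M - A n" and A_sub: "A n \<subseteq> space M" for n
    unfolding A_def B_def by (auto simp: not_le)
  have all_le_Suc: "(\<forall>k\<le>Suc n. P k) \<longleftrightarrow> (\<forall>k\<le>n. P k) \<and> P (Suc n)" for n :: nat and P
    by (metis le_Suc_eq)
  \<comment> \<open>Not having reached \<open>c\<close> by time \<open>n\<close> is an event of the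
    past, so \<open>step\<close> may be applied on it.\<close>
  have B_F: "B n \<in> sets (F n)" for n
  proof -
    have "{x \<in> space (F n). \<forall>k\<in>{..n}. V k x < c} \<in> sets (F n)"
      using adapted by (intro sets.sets_Collect_finite_All) auto
    moreover have "space (F n) = space M"
      using sub[of n] unfolding subalgebra_def by simp
    then have "{x \<in> space (F n). \<forall>k\<in>{..n}. V k x < c} = B n"
      unfolding B_def by auto
    ultimately show ?thesis by simp
  qed
  have [measurable]: "V n \<in> borel_measurable M" for n
    by (rule measurable_from_subalg[OF sub adapted[OF order_refl]])
  have [measurable]: "A n \<in> sets M" "B n \<in> sets M" for n
    unfolding A_def B_def by measurable
  have total: "c * emeasure M (A n) + (\<integral>\<^sup>+x. V n x * indicator (B n) x \<partial>M) \<le> (\<integral>\<^sup>+x. V 0 x \<partial>M)" for n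
  proof (induction n)
    case 0
    have "c * emeasure M (A 0) + (\<integral>\<^sup>+x. V 0 x * indicator (B 0) x \<partial>M)
        = (\<integral>\<^sup>+x. c * indicator (A 0) x + V 0 x * indicator (B 0) x \<partial>M)"
      by (simp add: nn_integral_add nn_integral_cmult_indicator)
    also have "\<dots> \<le> (\<integral>\<^sup>+x. V 0 x \<partial>M)"
      by (intro nn_integral_mono) (auto simp: A_def B_def indicator_def)
    finally show ?case .
  next
    case (Suc n)
    have "A n \<subseteq> A (Suc n)"
      unfolding A_def using le_SucI by blast
    \<comment> \<open>The level was either reached before or is reached for the first time at
      \<open>Suc n\<close>.\<close>
    then have "A (Suc n) = A n \<union> (A (Suc n) \<inter> B n)"
      using B_A[of n] A_sub[of "Suc n"] by blast
    moreover have "A n \<inter> (A (Suc n) \<inter> B n) = {}"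
      using B_A[of n] by blast
    ultimately have "emeasure M (A (Suc n)) = emeasure M (A n) + emeasure M (A (Suc n) \<inter> B n)"
      using plus_emeasure[of "A n" M "A (Suc n) \<inter> B n"] by simp
    then have "c * emeasure M (A (Suc n)) + (\<integral>\<^sup>+x. V (Suc n) x * indicator (B (Suc n)) x \<partial>M)
        = c * emeasure M (A n) + (\<integral>\<^sup>+x. c * indicator (A (Suc n) \<inter> B n) x
            + V (Suc n) x * indicator (B (Suc n)) x \<partial>M)"
      by (simp add: nn_integral_add nn_integral_cmult_indicator distrib_left add.assoc)
    \<comment> \<open>On \<open>B n\<close> there are two cases: if \<open>V (Suc n)\<close> is
      below \<open>c\<close> the path stays in \<open>B (Suc n)\<close>; otherwise its value is at
      least \<open>c\<close> and pays for the mass newly absorbed.\<close>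
    also have "\<dots> \<le> c * emeasure M (A n) + (\<integral>\<^sup>+x. V (Suc n) x * indicator (B n) x \<partial>M)"
    proof (intro add_left_mono nn_integral_mono)
      fix x assume "x \<in> space M"
      have "x \<in> B (Suc n) \<longleftrightarrow> x \<in> B n \<and> V (Suc n) x < c"
        using \<open>x \<in> space M\<close> by (simp add: B_def all_le_Suc)
      moreover have "x \<in> B (Suc n) \<longleftrightarrow> x \<notin> A (Suc n)"
        using \<open>x \<in> space M\<close> B_A by blast
      ultimately show "c * indicator (A (Suc n) \<inter> B n) x + V (Suc n) x * indicator (B (Suc n)) x
          \<le> V (Suc n) x * indicator (B n) x"
        by (cases "x \<in> B n"; cases "V (Suc n) x < c") (simp_all add: not_less)
    qed
    also have "\<dots> \<le> c * emeasure M (A n) + (\<integral>\<^sup>+x. V n x * indicator (B n) x \<partial>M)"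
      by (intro add_left_mono step B_F)
    also note Suc.IH
    finally show ?case .
  qed
  have le: "c * emeasure M (A n) \<le> (\<integral>\<^sup>+x. V 0 x \<partial>M)" for n
  proof -
    have "c * emeasure M (A n) \<le> c * emeasure M (A n) + (\<integral>\<^sup>+x. V n x * indicator (B n) x \<partial>M)"
      by simp
    also note total
    finally show ?thesis .
  qed
  have "{x \<in> space M. \<exists>n. c \<le> V n x} = (\<Union>n. A n)"
    by (auto simp: A_def)
  \<comment> \<open>Continuity from below removes the finite horizon.\<close>
  then have "emeasure M {x \<in> space M. \<exists>n. c \<le> V n x} = (SUP n. emeasure M (A n))"
    by (simp, intro SUP_emeasure_incseq[symmetric])
       (auto simp: incseq_def A_def intro: order_trans)
  then show ?thesis
    by (simp add: SUP_mult_left_ennreal SUP_le_iff le)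
qed

text \<open>A result of Robbins-Siegmund type. Divergence of the sums of \<open>a\<close> acts only
  on the means; the paths are then controlled by the maximal inequality. The bound
  \<open>a n \<le> 1\<close> keeps the factor \<open>1 - a n\<close> nonnegative, as
  \<open>ennreal\<close> arithmetic demands.\<close>

lemma (in prob_space) almost_supermartingale_AE_tendsto_0:
  fixes D :: "nat \<Rightarrow> 'a \<Rightarrow> real"
  assumes sub: "\<And>n. subalgebra M (F n)"
    and adapted: "\<And>k n. k \<le> n \<Longrightarrow> D k \<in> borel_measurable (F n)"
    and D: "\<And>n x. 0 \<le> D n x"
    and a: "\<And>n. 0 \<le> a n" "\<And>n. a n \<le> 1"
    and b: "\<And>n. 0 \<le> b n" "summable b"
    and div: "filterlim (\<lambda>n. \<Sum>k<n. a k) at_top sequentially"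
    and fin: "(\<integral>\<^sup>+x. ennreal (D 0 x) \<partial>M) < \<infinity>"
    and step: "\<And>n B. B \<in> sets (F n) \<Longrightarrow>
      (\<integral>\<^sup>+x. ennreal (D (Suc n) x) * indicator B x \<partial>M)
      \<le> (\<integral>\<^sup>+x. ennreal ((1 - a n) * D n x + b n) * indicator B x \<partial>M)"
  shows "AE x in M. (\<lambda>n. D n x) \<longlonglongrightarrow> 0"
proof -
  have [measurable]: "D n \<in> borel_measurable M" for n
    using measurable_from_subalg[OF sub adapted] by blast
  define E where "E n = (\<integral>\<^sup>+x. ennreal (D n x) \<partial>M)" for n
  \<comment> \<open>The whole space is an event of every \<open>F n\<close>; taking it for
    \<open>B\<close> yields a recursion for the means.\<close>
  have E_step: "E (Suc n) \<le> ennreal (1 - a n) * E n + ennreal (b n)" for n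
  proof -
    have "E (Suc n) = (\<integral>\<^sup>+x. ennreal (D (Suc n) x) * indicator (space M) x \<partial>M)"
      unfolding E_def by (intro nn_integral_cong) simp
    also have "\<dots> \<le> (\<integral>\<^sup>+x. ennreal ((1 - a n) * D n x + b n) * indicator (space M) x \<partial>M)"
      using sub[of n] by (intro step) (metis sets.top subalgebra_def)
    also have "\<dots> = (\<integral>\<^sup>+x. ennreal (1 - a n) * ennreal (D n x) + ennreal (b n) \<partial>M)"
      by (intro nn_integral_cong) (simp add: a b D ennreal_mult)
    also have "\<dots> = ennreal (1 - a n) * E n + ennreal (b n)"
      by (simp add: nn_integral_add nn_integral_cmult emeasure_space_1 E_def)
    finally show ?thesis .
  qed
  have E_fin: "E n < \<infinity>" for n
  proof (induction n)
    case (Suc n)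
    then have "ennreal (1 - a n) * E n + ennreal (b n) < \<infinity>"
      by (simp add: ennreal_mult_less_top)
    with E_step show ?case by (rule le_less_trans)
  qed (use fin in \<open>simp add: E_def\<close>)
  define e where "e n = enn2real (E n)" for n
  have E_eq: "E n = ennreal (e n)" and e_nn: "0 \<le> e n" for n
    using E_fin[of n] by (auto simp: e_def)
  have e_step: "e (Suc n) \<le> (1 - a n) * e n + b n" for n
    using E_step[of n] a[of n] b(1)[of n] e_nn[of n]
    by (simp add: E_eq ennreal_mult[symmetric] ennreal_plus[symmetric] del: ennreal_plus)
  have e0: "e \<longlonglongrightarrow> 0"
    by (rule perturbed_contraction_tendsto_0[OF e_nn a(1) b e_step div])
  \<comment> \<open>Adding the remaining perturbations makes the sequence a genuine supermartingale.\<close>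
  define T where "T n = (\<Sum>k. b (k + n))" for n
  have T: "T n = b n + T (Suc n)" for n
    using suminf_split_head[of "\<lambda>k. b (k + n)"] b(2) by (simp add: T_def)
  have T_nn: "0 \<le> T n" for n
    unfolding T_def by (intro suminf_nonneg) (auto simp: b)
  have T0: "T \<longlonglongrightarrow> 0"
    unfolding T_def using suminf_exist_split2[OF b(2)] .
  define V where "V n x = ennreal (D n x + T n)" for n x
  have [measurable]: "V n \<in> borel_measurable M" for n
    unfolding V_def by measurable
  have V_step: "(\<integral>\<^sup>+x. V (Suc n) x * indicator B x \<partial>M) \<le> (\<integral>\<^sup>+x. V n x * indicator B x \<partial>M)"
    if B: "B \<in> sets (F n)" for n B
  proof -
    have [measurable]: "B \<in> sets M"
      using B sub[of n] by (auto simp: subalgebra_def)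
    have "(\<integral>\<^sup>+x. V (Suc n) x * indicator B x \<partial>M)
      = (\<integral>\<^sup>+x. ennreal (D (Suc n) x) * indicator B x \<partial>M) + (\<integral>\<^sup>+x. ennreal (T (Suc n)) * indicator B x \<partial>M)"
      by (subst nn_integral_add[symmetric]) (auto simp: V_def D T_nn distrib_right)
    also have "\<dots> \<le> (\<integral>\<^sup>+x. ennreal ((1 - a n) * D n x + b n) * indicator B x \<partial>M)
        + (\<integral>\<^sup>+x. ennreal (T (Suc n)) * indicator B x \<partial>M)"
      by (intro add_right_mono step B)
    also have "\<dots> = (\<integral>\<^sup>+x. ennreal ((1 - a n) * D n x + b n + T (Suc n)) * indicator B x \<partial>M)"
      by (subst nn_integral_add[symmetric]) (auto simp: a b D T_nn distrib_right)
    also have "\<dots> \<le> (\<integral>\<^sup>+x. V n x * indicator B x \<partial>M)"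
      unfolding V_def using a D T[of n]
      by (intro nn_integral_mono mult_right_mono ennreal_leI) (auto simp: algebra_simps)
    finally show ?thesis .
  qed
  \<comment> \<open>The supermartingale is restarted at time \<open>m\<close> with the shifted
    filtration, so its initial mean \<open>e m + T m\<close> can be made small.\<close>
  have max: "c * emeasure M {x \<in> space M. \<exists>n. c \<le> V (n + m) x} \<le> ennreal (e m + T m)" for c m
  proof -
    have "c * emeasure M {x \<in> space M. \<exists>n. c \<le> V (n + m) x} \<le> (\<integral>\<^sup>+x. V (0 + m) x \<partial>M)"
    proof (rule maximal_inequality[where F = "\<lambda>n. F (n + m)"])
      show "subalgebra M (F (n + m))" for n by (rule sub)
      show "V (k + m) \<in> borel_measurable (F (n + m))" if "k \<le> n" for k n
      proof -
        have "D (k + m) \<in> borel_measurable (F (n + m))"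
          using that by (intro adapted) simp
        then show ?thesis
          unfolding V_def
          by (intro measurable_compose[OF _ measurable_ennreal] borel_measurable_add borel_measurable_const)
      qed
      show "(\<integral>\<^sup>+x. V (Suc n + m) x * indicator B x \<partial>M) \<le> (\<integral>\<^sup>+x. V (n + m) x * indicator B x \<partial>M)"
        if "B \<in> sets (F (n + m))" for n B
        using V_step[OF that] by simp
    qed
    also have "(\<integral>\<^sup>+x. V (0 + m) x \<partial>M) = E m + ennreal (T m)"
      by (simp add: V_def D T_nn nn_integral_add emeasure_space_1 E_def)
    finally show ?thesis by (simp add: E_eq e_nn T_nn)
  qed
  have "AE x in M. \<exists>m. \<forall>n. V (n + m) x < ennreal r" if "r > 0" for r
  proof -
    define N where "N = {x \<in> space M. \<forall>m. \<exists>n. ennreal r \<le> V (n + m) x}"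
    have [measurable]: "N \<in> sets M" unfolding N_def by measurable
    \<comment> \<open>\<open>N\<close> lies in the event of reaching \<open>r\<close> after time
      \<open>m\<close> for every \<open>m\<close>, while the bound tends to 0 in
      \<open>m\<close>.\<close>
    have "ennreal r * emeasure M N \<le> ennreal (e m + T m)" for m
    proof -
      have "ennreal r * emeasure M N \<le> ennreal r * emeasure M {x \<in> space M. \<exists>n. ennreal r \<le> V (n + m) x}"
        by (intro mult_left_mono emeasure_mono) (auto simp: N_def)
      also note max
      finally show ?thesis .
    qed
    moreover have "(\<lambda>m. ennreal (e m + T m)) \<longlonglongrightarrow> ennreal (0 + 0)"
      by (intro tendsto_ennrealI tendsto_add e0 T0)
    ultimately have "ennreal r * emeasure M N \<le> ennreal (0 + 0)"
      by (intro LIMSEQ_le_const) auto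
    with \<open>r > 0\<close> have "emeasure M N = 0" by simp
    then have "AE x in M. x \<notin> N"
      by (intro AE_not_in) auto
    then show ?thesis
      using AE_space by eventually_elim (auto simp: N_def not_le)
  qed
  \<comment> \<open>Countably many thresholds leave a single null set outside which all of them
    hold.\<close>
  then have "AE x in M. \<forall>j. \<exists>m. \<forall>n. V (n + m) x < ennreal (inverse (real (Suc j)))"
    by (subst AE_all_countable) (simp del: of_nat_Suc)
  then show ?thesis
  proof eventually_elim
    case (elim x)
    show ?case
    proof (rule LIMSEQ_I)
      fix r :: real assume "r > 0"
      then obtain j where j: "inverse (real (Suc j)) < r"
        using reals_Archimedean by blast
      from elim obtain m where m: "\<And>n. V (n + m) x < ennreal (inverse (real (Suc j)))"
        by blast
      have "norm (D n x - 0) < r" if "n \<ge> m" for n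
      proof -
        have "D n x + T n < inverse (real (Suc j))"
          using m[of "n - m"] that D[of n x] T_nn[of n]
          by (simp add: V_def ennreal_less_iff del: of_nat_Suc ennreal_plus)
        with j D[of n x] T_nn[of n] show ?thesis by simp
      qed
      then show "\<exists>m. \<forall>n\<ge>m. norm (D n x - 0) < r" by blast
    qed
  qed
qed


section \<open>One step of SGD and independence of the past\<close>

text \<open>Expand the square and integrate for a fixed \<open>w\<close>: the cross term is
  controlled by coercivity, the second moment of \<open>G w\<close> by comparison with
  \<open>G z\<close>.\<close>

lemma stochastic_gradient_step:
  fixes G :: "'a::euclidean_space \<Rightarrow> 's \<Rightarrow> 'a" and z :: 'a
  assumes "prob_space Q"
    and int: "\<And>w. integrable Q (G w)"
    and lip: "\<And>w s. s \<in> space Q \<Longrightarrow> norm (G w s - G z s) \<le> L * norm (w - z)"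
    and int_sq: "integrable Q (\<lambda>s. (norm (G z s))\<^sup>2)"
    and coercive: "m * (norm (w - z))\<^sup>2 \<le> (\<integral>s. G w s \<partial>Q) \<bullet> (w - z)"
    and "0 \<le> r"
  shows "(\<integral>\<^sup>+s. ennreal ((norm (w - r *\<^sub>R G w s - z))\<^sup>2) \<partial>Q)
    \<le> ennreal ((1 - 2 * r * m + 2 * L\<^sup>2 * r\<^sup>2) * (norm (w - z))\<^sup>2
        + 2 * r\<^sup>2 * (\<integral>s. (norm (G z s))\<^sup>2 \<partial>Q))"
proof -
  interpret prob_space Q by fact
  define v where "v = w - z"
  \<comment> \<open>A majorant involving \<open>G w s\<close> only linearly and \<open>G z s\<close>
    only through its squared norm, so \<open>int\<close> and \<open>int_sq\<close> give its
    integral.\<close>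
  define h where "h s = (norm v)\<^sup>2 - 2 * r * (G w s \<bullet> v)
    + r\<^sup>2 * (2 * L\<^sup>2 * (norm v)\<^sup>2 + 2 * (norm (G z s))\<^sup>2)" for s
  have le: "(norm (w - r *\<^sub>R G w s - z))\<^sup>2 \<le> h s" if "s \<in> space Q" for s
  proof -
    have "norm (G w s) \<le> norm (G w s - G z s) + norm (G z s)"
      by (metis diff_add_cancel norm_triangle_ineq)
    also have "\<dots> \<le> L * norm v + norm (G z s)"
      using lip[OF that] by (simp add: v_def)
    finally have "(norm (G w s))\<^sup>2 \<le> (L * norm v + norm (G z s))\<^sup>2"
      by (intro power_mono) auto
    \<comment> \<open>The inequality (a+b)^2 <= 2a^2 + 2b^2 is the source of both factors 2 in the
      bound.\<close>
    also have "\<dots> \<le> 2 * (L * norm v)\<^sup>2 + 2 * (norm (G z s))\<^sup>2"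
      using sum_squares_bound[of "L * norm v" "norm (G z s)"] by (simp add: power2_sum)
    finally have "(norm (G w s))\<^sup>2 \<le> 2 * L\<^sup>2 * (norm v)\<^sup>2 + 2 * (norm (G z s))\<^sup>2"
      by (simp add: power_mult_distrib)
    then have "r\<^sup>2 * (norm (G w s))\<^sup>2 \<le> r\<^sup>2 * (2 * L\<^sup>2 * (norm v)\<^sup>2 + 2 * (norm (G z s))\<^sup>2)"
      by (intro mult_left_mono) auto
    moreover have "(norm (w - r *\<^sub>R G w s - z))\<^sup>2
        = (norm v)\<^sup>2 - 2 * r * (G w s \<bullet> v) + r\<^sup>2 * (norm (G w s))\<^sup>2"
      unfolding v_def power2_norm_eq_inner
      by (simp add: inner_diff_left inner_diff_right inner_commute algebra_simps power2_eq_square)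
    ultimately show ?thesis by (simp add: h_def)
  qed
  have h_int: "integrable Q h"
    unfolding h_def using int int_sq by (intro Bochner_Integration.integrable_add
      Bochner_Integration.integrable_diff integrable_mult_right integrable_const integrable_inner_left) auto
  have h_nn: "0 \<le> h s" if "s \<in> space Q" for s
    using le[OF that] by (rule order_trans[rotated]) simp
  have "(\<integral>\<^sup>+s. ennreal ((norm (w - r *\<^sub>R G w s - z))\<^sup>2) \<partial>Q) \<le> (\<integral>\<^sup>+s. ennreal (h s) \<partial>Q)"
    by (intro nn_integral_mono ennreal_leI le)
  also have "\<dots> = ennreal (\<integral>s. h s \<partial>Q)"
    using h_int h_nn by (intro nn_integral_eq_integral) auto
  also have "(\<integral>s. h s \<partial>Q) = (norm v)\<^sup>2 - 2 * r * ((\<integral>s. G w s \<partial>Q) \<bullet> v)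
      + r\<^sup>2 * (2 * L\<^sup>2 * (norm v)\<^sup>2 + 2 * (\<integral>s. (norm (G z s))\<^sup>2 \<partial>Q))"
    unfolding h_def using int int_sq by (simp add: prob_space)
  also have "\<dots> \<le> (1 - 2 * r * m + 2 * L\<^sup>2 * r\<^sup>2) * (norm v)\<^sup>2
        + 2 * r\<^sup>2 * (\<integral>s. (norm (G z s))\<^sup>2 \<partial>Q)"
    using mult_left_mono[OF coercive, of "2 * r"] \<open>0 \<le> r\<close> by (simp add: v_def algebra_simps)
  finally show ?thesis by (simp add: v_def ennreal_leI)
qed

text \<open>The index blocks \<open>{..<n}\<close> and \<open>{n}\<close> are disjoint, so the
  corresponding restrictions are independent; the one-coordinate block is then projected to
  \<open>S\<close>. The product law is what allows Tonelli in the SGD step.\<close>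

lemma (in prob_space) indep_vars_distr_past_present:
  fixes X :: "nat \<Rightarrow> 'a \<Rightarrow> 's"
  assumes "indep_vars (\<lambda>_. S) X UNIV"
  shows "distr M (PiM {..<n} (\<lambda>_. S) \<Otimes>\<^sub>M S) (\<lambda>\<omega>. (restrict (\<lambda>i. X i \<omega>) {..<n}, X n \<omega>))
    = distr M (PiM {..<n} (\<lambda>_. S)) (\<lambda>\<omega>. restrict (\<lambda>i. X i \<omega>) {..<n}) \<Otimes>\<^sub>M distr M S (X n)"
proof -
  let ?Y = "\<lambda>\<omega>. restrict (\<lambda>i. X i \<omega>) {..<n}" and ?Z = "\<lambda>\<omega>. restrict (\<lambda>i. X i \<omega>) {n}"
  have "indep_var (PiM {..<n} (\<lambda>_. S)) ?Y (PiM {n} (\<lambda>_. S)) ?Z"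
    using assms by (intro indep_var_restrict) auto
  then have Y: "random_variable (PiM {..<n} (\<lambda>_. S)) ?Y" and Z: "random_variable (PiM {n} (\<lambda>_. S)) ?Z"
    and eq: "distr M (PiM {..<n} (\<lambda>_. S)) ?Y \<Otimes>\<^sub>M distr M (PiM {n} (\<lambda>_. S)) ?Z
      = distr M (PiM {..<n} (\<lambda>_. S) \<Otimes>\<^sub>M PiM {n} (\<lambda>_. S)) (\<lambda>\<omega>. (?Y \<omega>, ?Z \<omega>))"
    by (simp_all add: indep_var_distribution_eq)
  note [measurable] = Y Z
  have [measurable]: "(\<lambda>y. y n) \<in> PiM {n} (\<lambda>_. S) \<rightarrow>\<^sub>M S"
    by (rule measurable_component_singleton) simp
  have Xn: "distr M S (X n) = distr (distr M (PiM {n} (\<lambda>_. S)) ?Z) S (\<lambda>y. y n)"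
    by (simp add: distr_distr comp_def)
  interpret Xn: prob_space "distr M S (X n)"
    using assms by (intro prob_space_distr) (simp add: indep_vars_def)
  have "distr M (PiM {..<n} (\<lambda>_. S)) ?Y \<Otimes>\<^sub>M distr M S (X n)
    = distr (distr M (PiM {..<n} (\<lambda>_. S)) ?Y) (PiM {..<n} (\<lambda>_. S)) (\<lambda>y. y)
      \<Otimes>\<^sub>M distr (distr M (PiM {n} (\<lambda>_. S)) ?Z) S (\<lambda>y. y n)"
    unfolding Xn[symmetric] by (simp add: distr_id2)
  also have "\<dots> = distr (distr M (PiM {..<n} (\<lambda>_. S)) ?Y \<Otimes>\<^sub>M distr M (PiM {n} (\<lambda>_. S)) ?Z)
      (PiM {..<n} (\<lambda>_. S) \<Otimes>\<^sub>M S) (\<lambda>(y, z). (y, z n))"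
    by (rule pair_measure_distr)
       (auto simp: Xn[symmetric] intro: Xn.sigma_finite_measure_axioms)
  also have "\<dots> = distr M (PiM {..<n} (\<lambda>_. S) \<Otimes>\<^sub>M S) (\<lambda>\<omega>. (?Y \<omega>, X n \<omega>))"
    unfolding eq by (subst distr_distr) (auto simp: comp_def)
  finally show ?thesis by simp
qed

text \<open>Causality: step \<open>n\<close> has consumed only the samples before \<open>n\<close>.
  The two processes may live on different sample spaces, so the coordinate process can replace
  \<open>X\<close>.\<close>

lemma sgd_cong:
  assumes "\<And>i. i < n \<Longrightarrow> X i \<omega> = Y i y"
  shows "sgd f \<eta> X w0 n \<omega> = sgd f \<eta> Y w0 n y"
  using assms by (induction n) auto

text \<open>\<open>N\<close> is arbitrary because two instances are needed: the product space of
  past samples and the sigma-algebra they generate.\<close>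

lemma measurable_sgd:
  assumes G: "(\<lambda>(w, s). gradient (\<lambda>v. f v s) w) \<in> borel_measurable (borel \<Otimes>\<^sub>M S)"
    and X: "\<And>i. i < n \<Longrightarrow> X i \<in> N \<rightarrow>\<^sub>M S"
  shows "sgd f \<eta> X w0 n \<in> borel_measurable N"
  using X
proof (induction n)
  case (Suc n)
  have "(\<lambda>\<omega>. (\<lambda>(w, s). gradient (\<lambda>v. f v s) w) (sgd f \<eta> X w0 n \<omega>, X n \<omega>)) \<in> borel_measurable N"
    using Suc by (intro measurable_compose[OF _ G] measurable_Pair) auto
  then show ?case
    using Suc by (auto intro!: borel_measurable_diff borel_measurable_scaleR)
next
  case 0
  have "sgd f \<eta> X w0 0 = (\<lambda>_. w0)" by auto
  then show ?case by simp
qed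


lemma measurable_gradient_pair:
  fixes f :: "'a::euclidean_space \<Rightarrow> 's \<Rightarrow> real"
  assumes "\<And>w. f w \<in> borel_measurable S"
    and "\<And>s w. s \<in> space S \<Longrightarrow> (\<lambda>v. f v s) differentiable (at w)"
    and "\<And>s. s \<in> space S \<Longrightarrow> smooth_fun L (\<lambda>v. f v s)"
  shows "(\<lambda>(w, s). gradient (\<lambda>v. f v s) w) \<in> borel_measurable (borel \<Otimes>\<^sub>M S)"
proof (rule measurable_pair_continuous_left)
  fix s assume "s \<in> space S"
  then have lip: "dist (gradient (\<lambda>v. f v s) w) (gradient (\<lambda>v. f v s) w') \<le> L * dist w w'" for w w'
    using assms(3) by (simp add: smooth_fun_def dist_norm)
  \<comment> \<open>A Lipschitz constant must be nonnegative, and the sign of \<open>L\<close> is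
    not fixed here; hence the absolute value.\<close>
  have "lipschitz_on \<bar>L\<bar> UNIV (gradient (\<lambda>v. f v s))"
  proof (rule lipschitz_onI)
    show "dist (gradient (\<lambda>v. f v s) w) (gradient (\<lambda>v. f v s) w') \<le> \<bar>L\<bar> * dist w w'" for w w'
      using lip[of w w'] by (rule order_trans) (intro mult_right_mono abs_ge_self zero_le_dist)
  qed simp
  then show "continuous_on UNIV (\<lambda>w. gradient (\<lambda>v. f v s) w)"
    by (rule lipschitz_on_continuous_on)
qed (intro measurable_gradient assms)

text \<open>The freezing argument: the iterate is a function of the past and the new sample is
  independent of it, so the sample is integrated out with the iterate held fixed, where
  \<open>step\<close> applies.\<close>

lemma (in prob_space) sgd_nn_integral_step:
  fixes f :: "'b::euclidean_space \<Rightarrow> 's \<Rightarrow> real" and X :: "nat \<Rightarrow> 'a \<Rightarrow> 's"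
  assumes indep: "indep_vars (\<lambda>_. S) X UNIV"
    and G: "(\<lambda>(w, s). gradient (\<lambda>v. f v s) w) \<in> borel_measurable (borel \<Otimes>\<^sub>M S)"
    and step: "\<And>w. (\<integral>\<^sup>+s. ennreal ((norm (w - \<eta> n *\<^sub>R gradient (\<lambda>v. f v s) w - z))\<^sup>2) \<partial>distr M S (X n))
      \<le> ennreal (q * (norm (w - z))\<^sup>2 + c)"
    and B: "B \<in> sets (vimage_algebra (space M) (\<lambda>\<omega>. restrict (\<lambda>i. X i \<omega>) {..<n}) (PiM {..<n} (\<lambda>_. S)))"
  shows "(\<integral>\<^sup>+\<omega>. ennreal ((norm (sgd f \<eta> X w0 (Suc n) \<omega> - z))\<^sup>2) * indicator B \<omega> \<partial>M)
    \<le> (\<integral>\<^sup>+\<omega>. ennreal (q * (norm (sgd f \<eta> X w0 n \<omega> - z))\<^sup>2 + c) * indicator B \<omega> \<partial>M)"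
proof -
  let ?P = "PiM {..<n} (\<lambda>_. S)" and ?Q = "distr M S (X n)"
  define Y where "Y = (\<lambda>\<omega>. restrict (\<lambda>i. X i \<omega>) {..<n})"
  \<comment> \<open>The iterate as a function of the past samples: SGD driven by the coordinate process.\<close>
  define W where "W = sgd f \<eta> (\<lambda>i y. y i) w0 n"
  have X [measurable]: "X i \<in> M \<rightarrow>\<^sub>M S" for i
    using indep by (simp add: indep_vars_def)
  have Y [measurable]: "Y \<in> M \<rightarrow>\<^sub>M ?P"
    unfolding Y_def by (intro measurable_restrict X)
  have W [measurable]: "W \<in> borel_measurable ?P"
    unfolding W_def by (intro measurable_sgd[OF G] measurable_component_singleton) simp
  have sgd_n: "sgd f \<eta> X w0 n \<omega> = W (Y \<omega>)" for \<omega>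
    unfolding W_def Y_def by (rule sgd_cong) simp
  have "Y \<in> space M \<rightarrow> space ?P"
    using measurable_space[OF Y] by blast
  \<comment> \<open>Events of the past are preimages under \<open>Y\<close>, which makes the
    indicator of \<open>B\<close> a function of the past samples too.\<close>
  from B[folded Y_def] sets_vimage_algebra2[OF this] obtain C
    where C [measurable]: "C \<in> sets ?P" and B_eq: "B = Y -` C \<inter> space M"
    by blast
  define g where "g = (\<lambda>w s. gradient (\<lambda>v. f v s) w)"
  have g [measurable]: "(\<lambda>p. g (W (fst p)) (snd p)) \<in> borel_measurable (?P \<Otimes>\<^sub>M S)"
  proof -
    have "(\<lambda>p. (\<lambda>(w, s). g w s) (W (fst p), snd p)) \<in> borel_measurable (?P \<Otimes>\<^sub>M S)"
      using G unfolding g_def[symmetric] by (rule measurable_compose[rotated]) measurable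
    then show ?thesis by simp
  qed
  define \<phi> where "\<phi> p = ennreal ((norm (W (fst p) - \<eta> n *\<^sub>R g (W (fst p)) (snd p) - z))\<^sup>2)
      * indicator C (fst p)" for p
  have \<phi> [measurable]: "\<phi> \<in> borel_measurable (?P \<Otimes>\<^sub>M S)"
    unfolding \<phi>_def by measurable
  interpret Q: prob_space ?Q by (rule prob_space_distr) (rule X)
  have "(\<integral>\<^sup>+\<omega>. ennreal ((norm (sgd f \<eta> X w0 (Suc n) \<omega> - z))\<^sup>2) * indicator B \<omega> \<partial>M)
      = (\<integral>\<^sup>+\<omega>. \<phi> (Y \<omega>, X n \<omega>) \<partial>M)"
    by (intro nn_integral_cong) (simp add: \<phi>_def sgd_n B_eq g_def indicator_def)
  also have "\<dots> = (\<integral>\<^sup>+p. \<phi> p \<partial>distr M (?P \<Otimes>\<^sub>M S) (\<lambda>\<omega>. (Y \<omega>, X n \<omega>)))"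
    by (subst nn_integral_distr) auto
  \<comment> \<open>Independence enters here: the joint law of past and present is a
    product.\<close>
  also have "\<dots> = (\<integral>\<^sup>+p. \<phi> p \<partial>(distr M ?P Y \<Otimes>\<^sub>M ?Q))"
    unfolding Y_def indep_vars_distr_past_present[OF indep] ..
  also have "\<dots> = (\<integral>\<^sup>+y. \<integral>\<^sup>+s. \<phi> (y, s) \<partial>?Q \<partial>distr M ?P Y)"
    by (rule Q.nn_integral_fst[symmetric])
       (simp add: measurable_cong_sets[OF sets_pair_measure_cong[OF sets_distr sets_distr] refl])
  also have "\<dots> \<le> (\<integral>\<^sup>+y. ennreal (q * (norm (W y - z))\<^sup>2 + c) * indicator C y \<partial>distr M ?P Y)"
  proof (intro nn_integral_mono)
    fix y assume "y \<in> space (distr M ?P Y)"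
    then show "(\<integral>\<^sup>+s. \<phi> (y, s) \<partial>?Q) \<le> ennreal (q * (norm (W y - z))\<^sup>2 + c) * indicator C y"
      using step[of "W y"] by (cases "y \<in> C") (simp_all add: \<phi>_def g_def)
  qed
  also have "\<dots> = (\<integral>\<^sup>+\<omega>. ennreal (q * (norm (sgd f \<eta> X w0 n \<omega> - z))\<^sup>2 + c) * indicator B \<omega> \<partial>M)"
    by (subst nn_integral_distr)
       (auto simp: sgd_n B_eq indicator_def intro!: nn_integral_cong)
  finally show ?thesis .
qed

section \<open>Almost sure convergence of the SGD iterates\<close>

theorem theorem1:
  fixes M :: "'\<omega> measure" and S :: "'s measure"
    and \<xi> :: "'\<omega> \<Rightarrow> 's" and X :: "nat \<Rightarrow> '\<omega> \<Rightarrow> 's"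
    and f :: "real ^ 'd \<Rightarrow> 's \<Rightarrow> real" and F :: "real ^ 'd \<Rightarrow> real"
    and \<mu> L :: real and \<eta> :: "nat \<Rightarrow> real" and w0 w_star :: "real ^ 'd"
  assumes "prob_space M"
    and "\<xi> \<in> measurable M S"
    and iid_indep: "prob_space.indep_vars M (\<lambda>_. S) X UNIV"
    and iid_distr: "\<And>t. distr M S (X t) = distr M S \<xi>"
    and f_measurable: "\<And>w. f w \<in> borel_measurable S"
    and f_differentiable: "\<And>s w. s \<in> space S \<Longrightarrow> (\<lambda>v. f v s) differentiable (at w)"
    and f_integrable: "\<And>w. integrable M (\<lambda>\<omega>. f w (\<xi> \<omega>))"
    and F_eq: "\<And>w. F w = (\<integral>\<omega>. f w (\<xi> \<omega>) \<partial>M)"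
    and F_differentiable: "\<And>w. F differentiable (at w)"
    and grad_integrable: "\<And>w. integrable M (\<lambda>\<omega>. gradient (\<lambda>v. f v (\<xi> \<omega>)) w)"
    and unbiased: "\<And>w. (\<integral>\<omega>. gradient (\<lambda>v. f v (\<xi> \<omega>)) w \<partial>M) = gradient F w"
    and "\<mu> > 0" and "strongly_convex_fun \<mu> F"
    and "L > 0" and "\<And>s. s \<in> space S \<Longrightarrow> smooth_fun L (\<lambda>v. f v s)"
    and "\<And>s. s \<in> space S \<Longrightarrow> convex_fun (\<lambda>v. f v s)"
    and minimizer: "is_arg_min F (\<lambda>_. True) w_star"
    and "integrable M (\<lambda>\<omega>. (norm (gradient (\<lambda>v. f v (\<xi> \<omega>)) w_star))\<^sup>2)"
    and "\<And>t. 0 < \<eta> t" and "\<And>t. \<eta> t \<le> 1 / (2 * L)"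
    and "filterlim (\<lambda>n. \<Sum>t<n. \<eta> t) at_top sequentially"
    and "summable (\<lambda>t. (\<eta> t)\<^sup>2)"
  shows "AE \<omega> in M. (\<lambda>t. (norm (sgd f \<eta> X w0 t \<omega> - w_star))\<^sup>2) \<longlonglongrightarrow> 0"
proof -
  interpret prob_space M by fact
  define g where "g = (\<lambda>w s. gradient (\<lambda>v. f v s) w)"
  \<comment> \<open>The law of \<open>\<xi>\<close> and, by \<open>iid_distr\<close>, of every
    \<open>X n\<close>; it transfers the moment assumptions on \<open>\<xi>\<close> to the
    samples.\<close>
  define Q where "Q = distr M S \<xi>"
  define N where "N = (\<integral>s. (norm (g w_star s))\<^sup>2 \<partial>Q)"
  define c where "c n = 2 * (\<eta> n)\<^sup>2 * N" for n
  \<comment> \<open>The factor from \<open>stochastic_gradient_step\<close> with coercivity constant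
    \<open>\<mu> / 2\<close>, left unsimplified to match that lemma.\<close>
  define q where "q n = 1 - 2 * \<eta> n * (\<mu> / 2) + 2 * L\<^sup>2 * (\<eta> n)\<^sup>2" for n
  define E where "E n = (\<lambda>\<omega>. (norm (sgd f \<eta> X w0 n \<omega> - w_star))\<^sup>2)" for n
  define Y where "Y n = (\<lambda>\<omega>. restrict (\<lambda>i. X i \<omega>) {..<n})" for n
  define H where "H n = vimage_algebra (space M) (Y n) (PiM {..<n} (\<lambda>_. S))" for n
  note [measurable] = \<open>\<xi> \<in> M \<rightarrow>\<^sub>M S\<close>
  have G: "(\<lambda>(w, s). gradient (\<lambda>v. f v s) w) \<in> borel_measurable (borel \<Otimes>\<^sub>M S)"
    by (rule measurable_gradient_pair) fact+
  have X [measurable]: "X i \<in> M \<rightarrow>\<^sub>M S" for i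
    using iid_indep by (simp add: indep_vars_def)
  have g [measurable]: "g w \<in> borel_measurable S" for w
    unfolding g_def by (intro measurable_gradient f_measurable f_differentiable)
  have Q: "prob_space Q"
    unfolding Q_def by (rule prob_space_distr) measurable
  have N_nn: "0 \<le> N"
    unfolding N_def by simp
  have c_nn: "0 \<le> c n" for n
    by (simp add: c_def N_nn)

  have grad_step: "(\<integral>\<^sup>+s. ennreal ((norm (w - \<eta> n *\<^sub>R g w s - w_star))\<^sup>2) \<partial>Q)
      \<le> ennreal (q n * (norm (w - w_star))\<^sup>2 + c n)" for w n
    unfolding q_def c_def N_def
  proof (rule stochastic_gradient_step[OF Q])
    show "integrable Q (g w)" for w
      using grad_integrable[of w] by (simp add: Q_def integrable_distr_eq g_def[symmetric])
         (simp add: g_def)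
    show "norm (g w s - g w_star s) \<le> L * norm (w - w_star)" if "s \<in> space Q" for w s
      using that \<open>\<And>s. s \<in> space S \<Longrightarrow> smooth_fun L (\<lambda>v. f v s)\<close>[of s]
      by (simp add: Q_def smooth_fun_def g_def)
    show "integrable Q (\<lambda>s. (norm (g w_star s))\<^sup>2)"
      using \<open>integrable M (\<lambda>\<omega>. (norm (gradient (\<lambda>v. f v (\<xi> \<omega>)) w_star))\<^sup>2)\<close>
      unfolding Q_def by (subst integrable_distr_eq) (measurable, simp add: g_def)
    have "(\<integral>s. g w s \<partial>Q) = gradient F w"
      unfolding Q_def unbiased[symmetric] by (subst integral_distr) (measurable, simp add: g_def)
    moreover have "F w_star \<le> F w"
      using minimizer by (simp add: is_arg_min_linorder)
    \<comment> \<open>Strong convexity is taken with base point \<open>w\<close>, so that the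
      gradient at the current iterate appears.\<close>
    moreover have "F w_star - F w \<ge> gradient F w \<bullet> (w_star - w) + \<mu> / 2 * (norm (w_star - w))\<^sup>2"
      using \<open>strongly_convex_fun \<mu> F\<close> by (simp add: strongly_convex_fun_def)
    ultimately show "\<mu> / 2 * (norm (w - w_star))\<^sup>2 \<le> (\<integral>s. g w s \<partial>Q) \<bullet> (w - w_star)"
      by (simp add: norm_minus_commute inner_diff_right)
    show "0 \<le> \<eta> n" using \<open>\<And>t. 0 < \<eta> t\<close>[of n] by simp
  qed
  have E_step: "(\<integral>\<^sup>+\<omega>. ennreal (E (Suc n) \<omega>) * indicator B \<omega> \<partial>M)
      \<le> (\<integral>\<^sup>+\<omega>. ennreal (q n * E n \<omega> + c n) * indicator B \<omega> \<partial>M)" if "B \<in> sets (H n)" for n B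
    unfolding E_def
  proof (rule sgd_nn_integral_step[OF iid_indep G])
    show "(\<integral>\<^sup>+s. ennreal ((norm (w - \<eta> n *\<^sub>R gradient (\<lambda>v. f v s) w - w_star))\<^sup>2) \<partial>distr M S (X n))
      \<le> ennreal (q n * (norm (w - w_star))\<^sup>2 + c n)" for w
      using grad_step[of w n] by (simp add: iid_distr Q_def g_def)
  qed (use that in \<open>simp add: H_def Y_def\<close>)

  have Y: "Y n \<in> M \<rightarrow>\<^sub>M PiM {..<n} (\<lambda>_. S)" for n
    unfolding Y_def by (intro measurable_restrict X)
  have H_sub: "subalgebra M (H n)" for n
    unfolding subalgebra_def H_def using sets_image_in_sets[OF refl Y] by simp
  have E_meas: "E k \<in> borel_measurable (H n)" if "k \<le> n" for k n
  proof -
    have Y_H: "Y n \<in> H n \<rightarrow>\<^sub>M PiM {..<n} (\<lambda>_. S)"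
      unfolding H_def using measurable_space[OF Y] by (intro measurable_vimage_algebra1) blast
    have "X i \<in> H n \<rightarrow>\<^sub>M S" if "i < n" for i
    proof -
      have "(\<lambda>\<omega>. Y n \<omega> i) \<in> H n \<rightarrow>\<^sub>M S"
        using that by (intro measurable_compose[OF Y_H] measurable_component_singleton) simp
      then show ?thesis using that by (simp add: Y_def)
    qed
    with that have "sgd f \<eta> X w0 k \<in> borel_measurable (H n)"
      by (intro measurable_sgd[OF G]) auto
    then show ?thesis unfolding E_def by measurable
  qed
  have [measurable]: "E n \<in> borel_measurable M" for n
    by (rule measurable_from_subalg[OF H_sub E_meas[OF order_refl]])

  \<comment> \<open>The convergence lemma is started at a later time \<open>T\<close>, so the mean
    must be finite there. Early factors \<open>q n\<close> may exceed 1; only finiteness is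
    propagated, with \<open>\<bar>q n\<bar>\<close> as a nonnegative factor.\<close>
  have E_fin: "(\<integral>\<^sup>+\<omega>. ennreal (E n \<omega>) \<partial>M) < \<infinity>" for n
  proof (induction n)
    case 0
    show ?case by (simp add: E_def emeasure_space_1 ennreal_mult_less_top)
  next
    case (Suc n)
    have "(\<integral>\<^sup>+\<omega>. ennreal (E (Suc n) \<omega>) \<partial>M) = (\<integral>\<^sup>+\<omega>. ennreal (E (Suc n) \<omega>) * indicator (space M) \<omega> \<partial>M)"
      by (intro nn_integral_cong) simp
    also have "\<dots> \<le> (\<integral>\<^sup>+\<omega>. ennreal (q n * E n \<omega> + c n) * indicator (space M) \<omega> \<partial>M)"
      using sets.top[of "H n"] by (intro E_step) (simp add: H_def)
    also have "\<dots> \<le> (\<integral>\<^sup>+\<omega>. ennreal \<bar>q n\<bar> * ennreal (E n \<omega>) + ennreal (c n) \<partial>M)"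
    proof (intro nn_integral_mono)
      fix \<omega>
      have "ennreal (q n * E n \<omega> + c n) \<le> ennreal (\<bar>q n\<bar> * E n \<omega> + c n)"
        by (intro ennreal_leI add_right_mono mult_right_mono) (auto simp: E_def)
      also have "\<dots> = ennreal \<bar>q n\<bar> * ennreal (E n \<omega>) + ennreal (c n)"
        by (simp add: ennreal_mult E_def c_nn)
      finally show "ennreal (q n * E n \<omega> + c n) * indicator (space M) \<omega>
          \<le> ennreal \<bar>q n\<bar> * ennreal (E n \<omega>) + ennreal (c n)"
        by (simp add: indicator_def)
    qed
    also have "\<dots> = ennreal \<bar>q n\<bar> * (\<integral>\<^sup>+\<omega>. ennreal (E n \<omega>) \<partial>M) + ennreal (c n)"
      by (simp add: nn_integral_add nn_integral_cmult emeasure_space_1)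
    also have "\<dots> < \<infinity>"
      using Suc by (simp add: ennreal_mult_less_top)
    finally show ?case .
  qed

  have \<eta>0: "\<eta> \<longlonglongrightarrow> 0"
  proof -
    have "(\<lambda>t. sqrt ((\<eta> t)\<^sup>2)) \<longlonglongrightarrow> sqrt 0"
      by (intro tendsto_real_sqrt summable_LIMSEQ_zero) fact
    then show ?thesis using \<open>\<And>t. 0 < \<eta> t\<close> by (simp add: less_imp_le)
  qed
  have "(\<lambda>t. 2 * L\<^sup>2 * \<eta> t) \<longlonglongrightarrow> 0" "(\<lambda>t. \<mu> / 2 * \<eta> t) \<longlonglongrightarrow> 0"
    by (intro tendsto_mult_right_zero \<eta>0)+
  from this(1)[THEN order_tendstoD(2), of "\<mu> / 2"] this(2)[THEN order_tendstoD(2), of 1]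
  have "eventually (\<lambda>t. 2 * L\<^sup>2 * \<eta> t < \<mu> / 2) sequentially"
    "eventually (\<lambda>t. \<mu> / 2 * \<eta> t < 1) sequentially"
    using \<open>\<mu> > 0\<close> half_gt_zero zero_less_one by blast+
  then have "eventually (\<lambda>t. 2 * L\<^sup>2 * \<eta> t < \<mu> / 2 \<and> \<mu> / 2 * \<eta> t < 1) sequentially"
    by eventually_elim simp
  \<comment> \<open>The first bound lets the quadratic term of \<open>q t\<close> consume at most
    half of the contraction \<open>\<mu> * \<eta> t\<close>; the second provides
    \<open>a n \<le> 1\<close>.\<close>
  then obtain T where T: "\<And>t. t \<ge> T \<Longrightarrow> 2 * L\<^sup>2 * \<eta> t < \<mu> / 2" "\<And>t. t \<ge> T \<Longrightarrow> \<mu> / 2 * \<eta> t < 1"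
    unfolding eventually_sequentially by blast
  have q_le: "q t \<le> 1 - \<mu> / 2 * \<eta> t" if "t \<ge> T" for t
    using mult_right_mono[OF less_imp_le[OF T(1)[OF that]], of "\<eta> t"] \<open>\<And>t. 0 < \<eta> t\<close>[of t]
    by (simp add: q_def power2_eq_square algebra_simps)

  have "AE \<omega> in M. (\<lambda>n. E (n + T) \<omega>) \<longlonglongrightarrow> 0"
  proof (rule almost_supermartingale_AE_tendsto_0[where F = "\<lambda>n. H (n + T)"
        and a = "\<lambda>n. \<mu> / 2 * \<eta> (n + T)" and b = "\<lambda>n. c (n + T)"])
    show "summable (\<lambda>n. c (n + T))"
      unfolding c_def using \<open>summable (\<lambda>t. (\<eta> t)\<^sup>2)\<close>
      by (intro summable_mult summable_mult2 summable_ignore_initial_segment)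
    show "filterlim (\<lambda>n. \<Sum>k<n. \<mu> / 2 * \<eta> (k + T)) at_top sequentially"
    proof -
      \<comment> \<open>The shifted sum is the full one minus its fixed first \<open>T\<close>
        terms, scaled by a positive constant, so it still diverges.\<close>
      have "filterlim (\<lambda>n. \<mu> / 2 * (- (\<Sum>k<T. \<eta> k) + (\<Sum>k<n + T. \<eta> k))) at_top sequentially"
      proof (intro filterlim_tendsto_pos_mult_at_top[OF tendsto_const]
          filterlim_tendsto_add_at_top[OF tendsto_const])
        show "filterlim (\<lambda>n. \<Sum>k<n + T. \<eta> k) at_top sequentially"
          by (rule filterlim_compose[OF \<open>filterlim (\<lambda>n. \<Sum>t<n. \<eta> t) at_top sequentially\<close>])
             (rule filterlim_add_const_nat_at_top)
      qed (use \<open>\<mu> > 0\<close> in simp)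
      moreover have "(\<Sum>k<n. \<mu> / 2 * \<eta> (k + T)) = \<mu> / 2 * (- (\<Sum>k<T. \<eta> k) + (\<Sum>k<n + T. \<eta> k))" for n
        by (induction n) (simp_all add: algebra_simps)
      ultimately show ?thesis by (simp only:)
    qed
    show "(\<integral>\<^sup>+\<omega>. ennreal (E (Suc n + T) \<omega>) * indicator B \<omega> \<partial>M)
        \<le> (\<integral>\<^sup>+\<omega>. ennreal ((1 - \<mu> / 2 * \<eta> (n + T)) * E (n + T) \<omega> + c (n + T)) * indicator B \<omega> \<partial>M)"
      if "B \<in> sets (H (n + T))" for n B
    proof -
      have "(\<integral>\<^sup>+\<omega>. ennreal (E (Suc n + T) \<omega>) * indicator B \<omega> \<partial>M)
        \<le> (\<integral>\<^sup>+\<omega>. ennreal (q (n + T) * E (n + T) \<omega> + c (n + T)) * indicator B \<omega> \<partial>M)"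
        using E_step[OF that] by simp
      also have "\<dots> \<le> (\<integral>\<^sup>+\<omega>. ennreal ((1 - \<mu> / 2 * \<eta> (n + T)) * E (n + T) \<omega> + c (n + T))
          * indicator B \<omega> \<partial>M)"
        by (intro nn_integral_mono mult_right_mono ennreal_leI add_right_mono q_le) (auto simp: E_def)
      finally show ?thesis .
    qed
    show "0 \<le> \<mu> / 2 * \<eta> (n + T)" for n
      using \<open>\<mu> > 0\<close> \<open>\<And>t. 0 < \<eta> t\<close>[of "n + T"] by simp
    show "\<mu> / 2 * \<eta> (n + T) \<le> 1" for n
      using T(2)[of "n + T"] by simp
    show "0 \<le> E (n + T) \<omega>" for n \<omega>
      by (simp add: E_def)
    show "E (k + T) \<in> borel_measurable (H (n + T))" if "k \<le> n" for k n
      using that by (intro E_meas) simp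
  qed (use E_fin in \<open>simp_all add: H_sub c_nn\<close>)
  then show ?thesis
    by eventually_elim (rule LIMSEQ_offset[where k = T], simp add: E_def)
qed

end
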